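(* Let $N\ge 1$ be an integer and let $D$ be the directed graph with vertex set $[N]=\{1,\dots,N\}$ and directed-edge set $[N]\times[N]$. For an $N\times N$ Hermitian matrix $M=(M_{ij})$ and a directed edge $e=(i,j)$ write $M_e=M_{ij}$. Let $\mathcal A$ be the set of all pairs $(q,K)$ where $q\subseteq[N]\times[N]$ is a set of directed edges of $D$ and $K$ is a partition of $q$ into (edge sets of) directed cycles of $D$ of length at least three. Define the polynomial function $$\xi(M)=\sum_{(q,K)\in\mathcal A}\ \prod_{e\in q}M_e .$$ Then $$\langle \xi\rangle=\sum_{[(G,C)]}\frac{N(N-1)\cdots(N-|V(G)|+1)}{|\mathrm{Aut}(G,C)|\,N^{e(G)}},$$ where the sum is over all isomorphism classes of pairs $(G,C)$ in which $G$ is a simple graph with at most $N$ vertices and no isolated vertex, and $C$ is a specified directed cycle double cover of $G$.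
   Context: For a polynomial function $\varphi$ of the entries of an $N\times N$ Hermitian matrix $M$, the Gaussian matrix integral is $\langle\varphi\rangle=\frac{1}{Z_0(N)}\int_{\mathcal H_N}e^{-N\,\mathrm{Tr}(M^2/2)}\varphi(M)\,dM$, where $\mathcal H_N$ is the space of $N\times N$ Hermitian matrices, $dM=\prod_i dM_{ii}\prod_{i<j}d\,\mathrm{Re}(M_{ij})\,d\,\mathrm{Im}(M_{ij})$, and $Z_0(N)=\int_{\mathcal H_N}e^{-N\,\mathrm{Tr}(M^2/2)}dM$. A directed cycle of $D$ of length $k$ is a set of directed edges $(v_1,v_2),(v_2,v_3),\dots,(v_k,v_1)$ with $v_1,\dots,v_k$ distinct. A specified directed cycle double cover (DCDC) of a graph $G$ is a collection $C$ of directed cycles of $G$ (cycles of $G$ each given an orientation) such that every edge $\{x,y\}$ of $G$ is traversed by exactly two cycles of $C$, once in the direction $x\to y$ and once in the direction $y\to x$. Two pairs $(G,C)$, $(G',C')$ are isomorphic if there is a graph isomorphism $G\to G'$ mapping the oriented cycles of $C$ onto those of $C'$; $\mathrm{Aut}(G,C)$ is the group of automorphisms of $G$ mapping $C$ onto itself in this sense. $e(G)$ is the number of edges of $G$. The empty graph (with empty DCDC) is included and contributes $1$. *)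

theory Defs
  imports
    "HOL-Analysis.Embed_Measure"
    "HOL-Analysis.Lebesgue_Measure"
    "HOL-Library.Disjoint_Sets"
    "HOL-Combinatorics.Permutations"
    "Jordan_Normal_Form.Schur_Decomposition"
begin

text \<open>
  Matrix indices are zero-based, so the index and vertex set \<open>[N]\<close> is rendered as \<open>{..<N}\<close>.
\<close>

subsection \<open>The Gaussian integral over Hermitian matrices\<close>

definition hermitian_mats :: "nat \<Rightarrow> complex mat set" where
  "hermitian_mats N = {M \<in> carrier_mat N N. mat_adjoint M = M}"

text \<open>
  The real coordinates of a Hermitian matrix are indexed by \<open>[N] \<times> [N]\<close>: coordinate \<open>(i, i)\<close> is
  the diagonal entry \<open>M\<^sub>i\<^sub>i\<close>, and for \<open>i < j\<close> coordinate \<open>(i, j)\<close> is \<open>Re M\<^sub>i\<^sub>j\<close> and coordinate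
  \<open>(j, i)\<close> is \<open>Im M\<^sub>i\<^sub>j\<close>.
\<close>

definition herm_of_coords :: "nat \<Rightarrow> (nat \<times> nat \<Rightarrow> real) \<Rightarrow> complex mat" where
  "herm_of_coords N x = Matrix.mat N N (\<lambda>(i, j).
     if i = j then complex_of_real (x (i, i))
     else if i < j then Complex (x (i, j)) (x (j, i))
     else Complex (x (j, i)) (- x (i, j)))"

text \<open>
  The measure \<open>dM\<close>: Lebesgue measure in these coordinates, transported to the space of Hermitian
  matrices.
\<close>

definition herm_lebesgue :: "nat \<Rightarrow> complex mat measure" where
  "herm_lebesgue N =
     embed_measure (\<Pi>\<^sub>M p \<in> {..<N} \<times> {..<N}. (lborel :: real measure)) (herm_of_coords N)"

definition mat_trace :: "'a :: comm_monoid_add mat \<Rightarrow> 'a" where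
  "mat_trace A = (\<Sum>i<dim_row A. A $$ (i, i))"

text \<open>
  The complex exponential is used because traces are complex numbers here; \<open>Tr M\<^sup>2\<close> is real for
  Hermitian \<open>M\<close>.
\<close>

definition gauss_weight :: "nat \<Rightarrow> complex mat \<Rightarrow> complex" where
  "gauss_weight N M = exp (- (of_nat N * mat_trace ((1 / 2) \<cdot>\<^sub>m (M * M))))"

definition gauss_Z0 :: "nat \<Rightarrow> complex" where
  "gauss_Z0 N = (\<integral>M. gauss_weight N M \<partial>herm_lebesgue N)"

definition gauss_mean :: "nat \<Rightarrow> (complex mat \<Rightarrow> complex) \<Rightarrow> complex" where
  "gauss_mean N \<phi> = 1 / gauss_Z0 N * (\<integral>M. gauss_weight N M * \<phi> M \<partial>herm_lebesgue N)"

subsection \<open>Directed cycles and the polynomial \<open>\<xi>\<close>\<close>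

text \<open>
  A directed cycle is identified with its set of arcs
  \<open>(v\<^sub>1, v\<^sub>2), \<dots>, (v\<^sub>k, v\<^sub>1)\<close>; \<open>A\<close> is the arc set of the ambient digraph.
\<close>

definition dicycle :: "('a \<times> 'a) set \<Rightarrow> nat \<Rightarrow> ('a \<times> 'a) set \<Rightarrow> bool" where
  "dicycle A k c \<longleftrightarrow>
     (\<exists>vs. vs \<noteq> [] \<and> length vs = k \<and> distinct vs \<and> c = set (zip vs (rotate1 vs)) \<and> c \<subseteq> A)"

definition cycle_partitions :: "nat \<Rightarrow> ((nat \<times> nat) set \<times> (nat \<times> nat) set set) set" where
  "cycle_partitions N = {(q, K). q \<subseteq> {..<N} \<times> {..<N} \<and> partition_on q K \<and>
     (\<forall>c\<in>K. \<exists>k\<ge>3. dicycle ({..<N} \<times> {..<N}) k c)}"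

definition xi :: "nat \<Rightarrow> complex mat \<Rightarrow> complex" where
  "xi N M = (\<Sum>(q, K) \<in> cycle_partitions N. \<Prod>e\<in>q. M $$ e)"

subsection \<open>Graphs with a specified directed cycle double cover\<close>

definition simple_graph :: "'a set \<Rightarrow> 'a set set \<Rightarrow> bool" where
  "simple_graph V E \<longleftrightarrow> finite V \<and> (\<forall>e\<in>E. \<exists>x\<in>V. \<exists>y\<in>V. x \<noteq> y \<and> e = {x, y})"

definition no_isolated_vertex :: "'a set \<Rightarrow> 'a set set \<Rightarrow> bool" where
  "no_isolated_vertex V E \<longleftrightarrow> (\<forall>v\<in>V. \<exists>e\<in>E. v \<in> e)"

text \<open>
  A cycle of a simple graph has length at least three. Its two orientations are directed cycles of
  the digraph having both orientations of every edge as arcs; with length at least three they are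
  distinct as arc sets.
\<close>

definition oriented_cycle :: "'a set set \<Rightarrow> ('a \<times> 'a) set \<Rightarrow> bool" where
  "oriented_cycle E c \<longleftrightarrow> (\<exists>k\<ge>3. dicycle {(x, y). {x, y} \<in> E} k c)"

text \<open>
  No multiplicities are needed in \<open>C\<close>: a repeated cycle would traverse an edge twice in the same
  direction.
\<close>

definition is_DCDC :: "'a set set \<Rightarrow> ('a \<times> 'a) set set \<Rightarrow> bool" where
  "is_DCDC E C \<longleftrightarrow> (\<forall>c\<in>C. oriented_cycle E c) \<and>
     (\<forall>x y. {x, y} \<in> E \<longrightarrow>
        card {c \<in> C. (x, y) \<in> c \<or> (y, x) \<in> c} = 2 \<and>
        (\<exists>!c. c \<in> C \<and> (x, y) \<in> c) \<and> (\<exists>!c. c \<in> C \<and> (y, x) \<in> c))"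

text \<open>A pair \<open>(G, C)\<close> with \<open>G = (V, E)\<close> is represented by the triple \<open>(V, E, C)\<close>.\<close>

type_synonym 'a graph_cover = "'a set \<times> 'a set set \<times> ('a \<times> 'a) set set"

fun iso_via :: "('a \<Rightarrow> 'b) \<Rightarrow> 'a graph_cover \<Rightarrow> 'b graph_cover \<Rightarrow> bool" where
  "iso_via f (V, E, C) (V', E', C') \<longleftrightarrow>
     bij_betw f V V' \<and> (\<lambda>e. f ` e) ` E = E' \<and> (\<lambda>c. map_prod f f ` c) ` C = C'"

definition iso_pairs :: "'a graph_cover \<Rightarrow> 'b graph_cover \<Rightarrow> bool" where
  "iso_pairs P P' \<longleftrightarrow> (\<exists>f. iso_via f P P')"

text \<open>
  Automorphisms are maps on \<open>V\<close>; as total functions they are normalised to be the identity outside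
  \<open>V\<close>, which is part of \<^const>\<open>permutes\<close>.
\<close>

definition Aut :: "'a graph_cover \<Rightarrow> ('a \<Rightarrow> 'a) set" where
  "Aut P = {f. f permutes fst P \<and> iso_via f P P}"

text \<open>Every finite graph is isomorphic to one whose vertices are natural numbers.\<close>

definition DCDC_pairs :: "nat \<Rightarrow> nat graph_cover set" where
  "DCDC_pairs N = {(V, E, C). simple_graph V E \<and> card V \<le> N \<and> no_isolated_vertex V E \<and>
     is_DCDC E C}"

definition iso_rel :: "nat \<Rightarrow> (nat graph_cover \<times> nat graph_cover) set" where
  "iso_rel N = {(P, P'). P \<in> DCDC_pairs N \<and> P' \<in> DCDC_pairs N \<and> iso_pairs P P'}"

text \<open>\<open>N (N - 1) \<cdots> (N - |V(G)| + 1) / (|Aut (G, C)| N\<^bsup>e(G)\<^esup>)\<close>\<close>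

fun pair_weight :: "nat \<Rightarrow> 'a graph_cover \<Rightarrow> real" where
  "pair_weight N (V, E, C) =
     (\<Prod>i<card V. real N - real i) / (real (card (Aut (V, E, C))) * real N ^ card E)"

definition class_weight :: "nat \<Rightarrow> nat graph_cover set \<Rightarrow> real" where
  "class_weight N X = pair_weight N (SOME P. P \<in> X)"

subsection \<open>Basic properties of these definitions\<close>

lemma mat_adjoint_index:
  assumes "M \<in> carrier_mat N N" "i < N" "j < N"
  shows "mat_adjoint M $$ (i, j) = cnj (M $$ (j, i))"
  using assms unfolding mat_adjoint_def by (simp add: mat_of_rows_def)

lemma hermitian_mats_iff:
  "M \<in> hermitian_mats N \<longleftrightarrow>
     M \<in> carrier_mat N N \<and> (\<forall>i<N. \<forall>j<N. M $$ (i, j) = cnj (M $$ (j, i)))"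
proof (cases "M \<in> carrier_mat N N")
  case True
  have "mat_adjoint M = M \<longleftrightarrow> (\<forall>i<N. \<forall>j<N. mat_adjoint M $$ (i, j) = M $$ (i, j))"
    using True by (auto simp: mat_eq_iff mat_adjoint_def)
  then show ?thesis
    using True mat_adjoint_index[OF True] unfolding hermitian_mats_def
    by (metis (mono_tags, lifting) mem_Collect_eq)
qed (auto simp: hermitian_mats_def)

lemma bij_betw_herm_of_coords:
  "bij_betw (herm_of_coords N) (space (\<Pi>\<^sub>M p \<in> {..<N} \<times> {..<N}. (lborel :: real measure)))
     (hermitian_mats N)"
proof (rule bij_betw_byWitness[where f' = "\<lambda>M. \<lambda>(i, j) \<in> {..<N} \<times> {..<N}.
      if i \<le> j then Re (M $$ (i, j)) else Im (M $$ (j, i))"])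
  show "\<forall>x\<in>space (\<Pi>\<^sub>M p \<in> {..<N} \<times> {..<N}. (lborel :: real measure)).
     (\<lambda>(i, j) \<in> {..<N} \<times> {..<N}. if i \<le> j then Re (herm_of_coords N x $$ (i, j))
       else Im (herm_of_coords N x $$ (j, i))) = x"
    by (auto simp: space_PiM herm_of_coords_def PiE_def extensional_def fun_eq_iff)
  show "\<forall>M\<in>hermitian_mats N. herm_of_coords N (\<lambda>(i, j) \<in> {..<N} \<times> {..<N}.
      if i \<le> j then Re (M $$ (i, j)) else Im (M $$ (j, i))) = M"
  proof
    fix M assume "M \<in> hermitian_mats N"
    then have M: "M \<in> carrier_mat N N"
      and h: "\<And>i j. i < N \<Longrightarrow> j < N \<Longrightarrow> M $$ (i, j) = cnj (M $$ (j, i))"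
      unfolding hermitian_mats_iff by blast+
    have d: "complex_of_real (Re (M $$ (i, i))) = M $$ (i, i)" if "i < N" for i
      using arg_cong[OF h[OF that that], of Im] by (simp add: complex_eq_iff)
    have l: "Complex (Re (M $$ (j, i))) (- Im (M $$ (j, i))) = M $$ (i, j)"
      if "i < N" "j < N" for i j
      unfolding h[OF that] by (simp add: complex_eq_iff)
    show "herm_of_coords N (\<lambda>(i, j) \<in> {..<N} \<times> {..<N}.
      if i \<le> j then Re (M $$ (i, j)) else Im (M $$ (j, i))) = M"
      using M by (intro eq_matI) (auto simp: herm_of_coords_def d l)
  qed
  show "herm_of_coords N ` space (\<Pi>\<^sub>M p \<in> {..<N} \<times> {..<N}. (lborel :: real measure))
     \<subseteq> hermitian_mats N"
    by (auto simp: hermitian_mats_iff herm_of_coords_def complex_eq_iff)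
  show "(\<lambda>M. \<lambda>(i, j) \<in> {..<N} \<times> {..<N}. if i \<le> j then Re (M $$ (i, j)) else Im (M $$ (j, i))) `
     hermitian_mats N \<subseteq> space (\<Pi>\<^sub>M p \<in> {..<N} \<times> {..<N}. (lborel :: real measure))"
    unfolding space_PiM by (intro image_subsetI restrict_PiE[THEN iffD2] Pi_I) simp
qed

lemma space_herm_lebesgue: "space (herm_lebesgue N) = hermitian_mats N"
  using bij_betw_herm_of_coords[of N]
  by (simp add: herm_lebesgue_def space_embed_measure bij_betw_def)

definition wf_cover :: "'a graph_cover \<Rightarrow> bool" where
  "wf_cover P \<longleftrightarrow> (case P of (V, E, C) \<Rightarrow>
     finite V \<and> (\<forall>e\<in>E. e \<subseteq> V) \<and> (\<forall>c\<in>C. c \<subseteq> V \<times> V))"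

lemma DCDC_pairs_wf: "P \<in> DCDC_pairs N \<Longrightarrow> wf_cover P"
proof -
  assume "P \<in> DCDC_pairs N"
  then obtain V E C where P: "P = (V, E, C)" "simple_graph V E" "is_DCDC E C"
    by (auto simp: DCDC_pairs_def)
  have E: "\<forall>e\<in>E. e \<subseteq> V" using P(2) by (fastforce simp: simple_graph_def)
  have "\<forall>c\<in>C. c \<subseteq> V \<times> V"
  proof
    fix c assume "c \<in> C"
    then have "c \<subseteq> {(x, y). {x, y} \<in> E}"
      using P(3) by (auto simp: is_DCDC_def oriented_cycle_def dicycle_def)
    then show "c \<subseteq> V \<times> V" using E by blast
  qed
  then show ?thesis using P E by (simp add: wf_cover_def simple_graph_def)
qed

lemma iso_via_id: "iso_via id P P"
  by (cases P) (simp add: map_prod.id)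

lemma image_image_map_prod:
  "(\<lambda>c. map_prod g g ` c) ` (\<lambda>c. map_prod f f ` c) ` C =
     (\<lambda>c. map_prod (g \<circ> f) (g \<circ> f) ` c) ` C"
  unfolding image_image map_prod.comp[symmetric] by simp

lemma iso_via_comp:
  assumes "iso_via f P Q" "iso_via g Q R"
  shows "iso_via (g \<circ> f) P R"
proof -
  obtain V E C V' E' C' V'' E'' C'' where
    PQR: "P = (V, E, C)" "Q = (V', E', C')" "R = (V'', E'', C'')"
    by (cases P; cases Q; cases R)
  have "bij_betw (g \<circ> f) V V''" using assms PQR by (auto intro: bij_betw_trans)
  moreover have "(\<lambda>e. (g \<circ> f) ` e) ` E = E''" using assms PQR by (auto simp: image_comp)
  moreover have "(\<lambda>c. map_prod (g \<circ> f) (g \<circ> f) ` c) ` C = C''"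
    unfolding image_image_map_prod[symmetric] using assms PQR by simp
  ultimately show ?thesis using PQR by simp
qed

lemma iso_via_cong:
  assumes wf: "wf_cover P" and eq: "\<And>v. v \<in> fst P \<Longrightarrow> f v = g v"
  shows "iso_via f P Q \<longleftrightarrow> iso_via g P Q"
proof -
  obtain V E C V' E' C' where PQ: "P = (V, E, C)" "Q = (V', E', C')"
    by (cases P; cases Q)
  have e: "f v = g v" if "v \<in> V" for v using eq that PQ by simp
  have "(\<lambda>e. f ` e) ` E = (\<lambda>e. g ` e) ` E"
    using wf PQ e by (intro image_cong) (auto simp: wf_cover_def subset_iff intro!: image_cong)
  moreover have "(\<lambda>c. map_prod f f ` c) ` C = (\<lambda>c. map_prod g g ` c) ` C"
  proof (rule image_cong[OF refl])
    fix c assume "c \<in> C"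
    then have "c \<subseteq> V \<times> V" using wf PQ by (auto simp: wf_cover_def)
    then show "map_prod f f ` c = map_prod g g ` c"
      using e by (intro image_cong) auto
  qed
  moreover have "bij_betw f V V' \<longleftrightarrow> bij_betw g V V'" using e by (rule bij_betw_cong)
  ultimately show ?thesis using PQ by simp
qed

lemma iso_via_inv:
  assumes wf: "wf_cover P" and iso: "iso_via f P Q"
  shows "iso_via (inv_into (fst P) f) Q P"
proof -
  obtain V E C V' E' C' where PQ: "P = (V, E, C)" "Q = (V', E', C')"
    by (cases P; cases Q)
  let ?g = "inv_into V f"
  have b: "bij_betw f V V'" using iso PQ by simp
  have inv: "(?g \<circ> f) v = id v" if "v \<in> V" for v
    using b that by (simp add: bij_betw_def)
  have "iso_via (?g \<circ> f) P P"
    using iso_via_cong[OF wf, of "?g \<circ> f" id P] inv PQ iso_via_id[of P]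
    by (metis fst_conv)
  then have "(\<lambda>e. (?g \<circ> f) ` e) ` E = E"
    "(\<lambda>c. map_prod (?g \<circ> f) (?g \<circ> f) ` c) ` C = C"
    using PQ by simp_all
  then have "(\<lambda>e. ?g ` e) ` (\<lambda>e. f ` e) ` E = E"
    "(\<lambda>c. map_prod ?g ?g ` c) ` (\<lambda>c. map_prod f f ` c) ` C = C"
    unfolding image_image_map_prod by (simp_all add: image_image image_comp)
  then show ?thesis using iso PQ b by (auto simp: bij_betw_inv_into)
qed

lemma equiv_iso_rel: "equiv (DCDC_pairs N) (iso_rel N)"
proof (rule equivI)
  show "iso_rel N \<subseteq> DCDC_pairs N \<times> DCDC_pairs N" by (auto simp: iso_rel_def)
  show "refl_on (DCDC_pairs N) (iso_rel N)"
    by (auto simp: refl_on_def iso_rel_def iso_pairs_def intro: iso_via_id)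
  show "sym (iso_rel N)"
    unfolding sym_def iso_rel_def iso_pairs_def using iso_via_inv DCDC_pairs_wf by blast
  show "trans (iso_rel N)"
    unfolding trans_def iso_rel_def iso_pairs_def using iso_via_comp by blast
qed

lemma finite_iso_classes: "finite (DCDC_pairs N // iso_rel N)"
proof -
  let ?S = "Pow {..<N} \<times> Pow (Pow {..<N}) \<times> Pow (Pow ({..<N} \<times> {..<N}))"
  let ?h = "\<lambda>X. {Q \<in> ?S. \<exists>P\<in>X. iso_pairs P Q}"
  have ne: "\<exists>Q\<in>?S. iso_pairs P Q" if "P \<in> DCDC_pairs N" for P :: "nat graph_cover"
  proof -
    obtain V E C where P: "P = (V, E, C)" by (cases P)
    have wf: "finite V" "\<forall>e\<in>E. e \<subseteq> V" "\<forall>c\<in>C. c \<subseteq> V \<times> V" and c: "card V \<le> N"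
      using DCDC_pairs_wf[OF that] that P by (auto simp: wf_cover_def DCDC_pairs_def)
    obtain f where f: "bij_betw f V {..<card V}"
      using finite_same_card_bij[OF wf(1), of "{..<card V}"] by auto
    have fN: "f v \<in> {..<N}" if "v \<in> V" for v
      using bij_betwE[OF f] c that by (meson lessThan_iff less_le_trans)
    let ?Q = "({..<card V}, (\<lambda>e. f ` e) ` E, (\<lambda>c. map_prod f f ` c) ` C)"
    have "iso_via f P ?Q" using f P by simp
    then have "iso_pairs P ?Q" unfolding iso_pairs_def by (rule exI[of "\<lambda>g. iso_via g P ?Q" f])
    moreover have "?Q \<in> ?S"
    proof -
      have "f ` e \<subseteq> {..<N}" if "e \<in> E" for e using wf(2) fN that by blast
      moreover have "map_prod f f ` c \<subseteq> {..<N} \<times> {..<N}" if "c \<in> C" for c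
        using wf(3) fN that by fastforce
      ultimately show ?thesis using c by auto
    qed
    ultimately show ?thesis by (rule bexI)
  qed
  have "inj_on ?h (DCDC_pairs N // iso_rel N)"
  proof (rule inj_onI)
    fix X Y assume X: "X \<in> DCDC_pairs N // iso_rel N" and Y: "Y \<in> DCDC_pairs N // iso_rel N"
      and eq: "?h X = ?h Y"
    from X have "X \<noteq> {}" by (rule in_quotient_imp_non_empty[OF equiv_iso_rel])
    then obtain P where P: "P \<in> DCDC_pairs N" "P \<in> X"
      using in_quotient_imp_subset[OF equiv_iso_rel X] by (meson all_not_in_conv subsetD)
    obtain Q where Q: "Q \<in> ?S" "iso_pairs P Q" using ne[OF P(1)] by (elim bexE)
    have "Q \<in> ?h X" using Q P(2) by (intro CollectI conjI bexI)
    then have "Q \<in> ?h Y" by (simp only: eq)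
    then obtain P' where P': "P' \<in> Y" "iso_pairs P' Q" by (elim CollectE conjE bexE)
    have P'D: "P' \<in> DCDC_pairs N"
      using in_quotient_imp_subset[OF equiv_iso_rel Y] P'(1) by (rule subsetD)
    obtain f g where "iso_via f P Q" "iso_via g P' Q"
      using Q(2) P'(2) unfolding iso_pairs_def by (elim exE)
    then have "iso_via (inv_into (fst P') g \<circ> f) P P'"
      using iso_via_comp iso_via_inv[OF DCDC_pairs_wf[OF P'D]] by metis
    then have "iso_pairs P P'"
      unfolding iso_pairs_def by (rule exI[of "\<lambda>h. iso_via h P P'"])
    then have "(P, P') \<in> iso_rel N" using P(1) P'D by (simp add: iso_rel_def)
    then show "X = Y" using quotient_eqI[OF equiv_iso_rel X Y P(2) P'(1)] by simp
  qed
  moreover have "finite (?h ` (DCDC_pairs N // iso_rel N))"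
  proof (rule finite_subset)
    show "?h ` (DCDC_pairs N // iso_rel N) \<subseteq> Pow ?S" by (intro image_subsetI PowI Collect_restrict)
    show "finite (Pow ?S)" by (intro finite_Pow_iff[THEN iffD2] finite_cartesian_product) simp_all
  qed
  ultimately show ?thesis by (rule finite_imageD[rotated])
qed

lemma pair_weight_iso:
  assumes "wf_cover P" "wf_cover Q" "iso_via f P Q"
  shows "pair_weight N P = pair_weight N Q"
proof -
  obtain V E C V' E' C' where PQ: "P = (V, E, C)" "Q = (V', E', C')"
    by (cases P; cases Q)
  have le: "card (Aut R) \<le> card (Aut S)"
    if wf: "wf_cover R" "wf_cover S" and g: "iso_via g R S"
    for R :: "'x graph_cover" and S :: "'y graph_cover" and g
  proof -
    let ?i = "inv_into (fst R) g"
    let ?t = "\<lambda>a v. if v \<in> fst S then (g \<circ> a \<circ> ?i) v else v"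
    have b: "bij_betw g (fst R) (fst S)" using g by (cases R; cases S) simp
    have inj: "inj_on ?t (Aut R)"
    proof (rule inj_onI, rule ext)
      fix a a' v assume a: "a \<in> Aut R" "a' \<in> Aut R" and eq: "?t a = ?t a'"
      have p: "a permutes fst R" "a' permutes fst R" using a by (auto simp: Aut_def)
      show "a v = a' v"
      proof (cases "v \<in> fst R")
        case True
        then have gv: "g v \<in> fst S" "?i (g v) = v" using b by (auto simp: bij_betw_def)
        have "g (a v) = g (a' v)" using fun_cong[OF eq, of "g v"] gv by simp
        then show ?thesis
          using b p True by (meson bij_betw_imp_inj_on inj_on_eq_iff permutes_in_image)
      next
        case False
        then show ?thesis using p by (simp add: permutes_def)
      qed
    qed
    have "?t ` Aut R \<subseteq> Aut S"
    proof safe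
      fix a assume a: "a \<in> Aut R"
      have iso: "iso_via (g \<circ> a \<circ> ?i) S S"
        using iso_via_comp[OF iso_via_comp[OF iso_via_inv[OF wf(1) g]] g, of a] a
        by (simp add: Aut_def comp_assoc)
      have iso': "iso_via (?t a) S S"
        using iso iso_via_cong[OF wf(2), of "?t a" "g \<circ> a \<circ> ?i" S] by simp
      then have "bij_betw (?t a) (fst S) (fst S)" by (cases S) simp
      then have "?t a permutes fst S" by (rule bij_imp_permutes) simp
      then show "?t a \<in> Aut S" using iso' by (simp add: Aut_def)
    qed
    moreover have "finite (Aut S)"
      using finite_permutations[of "fst S"] wf(2)
      by (auto simp: Aut_def wf_cover_def split: prod.splits elim: finite_subset[rotated])
    ultimately show ?thesis using inj by (rule card_inj_on_le[rotated 1])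
  qed
  have "card (Aut P) = card (Aut Q)"
    using le[OF assms] le[OF assms(2,1) iso_via_inv[OF assms(1,3)]] by simp
  moreover have "card V = card V'" using assms(3) PQ by (auto dest: bij_betw_same_card)
  moreover have "card E = card E'"
  proof -
    have "inj_on f V" using assms(3) PQ by (auto simp: bij_betw_def)
    then have "inj_on (\<lambda>e. f ` e) E"
      using assms(1) PQ by (intro inj_onI) (auto simp: wf_cover_def inj_on_image_eq_iff)
    then show ?thesis using assms(3) PQ by (auto simp: card_image)
  qed
  ultimately show ?thesis using PQ by simp
qed

lemma class_weight_eq:
  assumes "X \<in> DCDC_pairs N // iso_rel N" "P \<in> X"
  shows "class_weight N X = pair_weight N P"
proof -
  have "(SOME P. P \<in> X) \<in> X" using assms(2) by (rule someI)
  then have "(SOME P. P \<in> X, P) \<in> iso_rel N"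
    using quotient_eq_iff[OF equiv_iso_rel assms(1,1) _ assms(2)] by blast
  then show ?thesis
    unfolding class_weight_def
    by (auto simp: iso_rel_def iso_pairs_def intro: pair_weight_iso DCDC_pairs_wf)
qed

end

theory Submission
  imports Defs "HOL-Probability.Distributions"
begin

text \<open>
  In the real coordinates of \<open>M\<close> the Gaussian weight is a product of one-dimensional Gaussians, so
  distinct unordered pairs \<open>{i, j}\<close> are independent, \<open>\<langle>M\<^sub>i\<^sub>j\<rangle> = 0\<close> and \<open>\<langle>M\<^sub>i\<^sub>j M\<^sub>j\<^sub>i\<rangle> = 1 / N\<close>. Hence
  a loop-free arc set \<open>q\<close> contributes \<open>N\<^bsup>-e\<^esup>\<close> if it is symmetric, that is, the arc set of a simple
  graph with \<open>e\<close> edges, and \<open>0\<close> otherwise. A partition of a symmetric \<open>q\<close> into directed cycles of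
  length at least three is a DCDC of that graph, because such a cycle never contains two opposite
  arcs. So \<open>\<langle>\<xi>\<rangle>\<close> sums \<open>N\<^bsup>-e\<^esup>\<close> over the labelled covers on subsets of \<open>[N]\<close>, and by orbit
  counting an isomorphism class has \<open>N (N - 1) \<cdots> (N - |V| + 1) / |Aut|\<close> labelled copies.
\<close>

section \<open>Gaussian moments of monomials\<close>

text \<open>\<open>exp (- (a * t^2))\<close> is \<open>sqrt (pi / a)\<close> times the centred
  normal density of variance \<open>1 / (2 * a)\<close>, so its moments of order 0, 1 and 2 come
  from those of the normal law.\<close>

lemma gaussian_moments:
  fixes a :: real
  assumes a: "a > 0"
  shows "has_bochner_integral lborel (\<lambda>t. complex_of_real (exp (- (a * t\<^sup>2)))) (sqrt (pi / a))"
    and "has_bochner_integral lborel (\<lambda>t. complex_of_real (exp (- (a * t\<^sup>2)) * t)) 0"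
    and "has_bochner_integral lborel (\<lambda>t. complex_of_real (exp (- (a * t\<^sup>2)) * t\<^sup>2))
      (sqrt (pi / a) / (2 * a))"
proof -
  define \<sigma> where "\<sigma> = 1 / sqrt (2 * a)"
  have \<sigma>: "\<sigma> > 0" "\<sigma>\<^sup>2 = 1 / (2 * a)"
    using a by (simp_all add: \<sigma>_def power_divide)
  have density: "sqrt (pi / a) * normal_density 0 \<sigma> t = exp (- (a * t\<^sup>2))" for t
    using a by (simp add: normal_density_def \<sigma>(2) real_sqrt_divide field_simps)
  have lift: "has_bochner_integral lborel (\<lambda>t. complex_of_real (exp (- (a * t\<^sup>2)) * t ^ k))
      (complex_of_real (sqrt (pi / a) * m))"
    if "has_bochner_integral lborel (\<lambda>t. normal_density 0 \<sigma> t * t ^ k) m" for k m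
  proof -
    have "has_bochner_integral lborel (\<lambda>t. sqrt (pi / a) * (normal_density 0 \<sigma> t * t ^ k))
        (sqrt (pi / a) * m)"
      using that by (rule has_bochner_integral_mult_right)
    then have "has_bochner_integral lborel (\<lambda>t. exp (- (a * t\<^sup>2)) * t ^ k) (sqrt (pi / a) * m)"
      by (simp only: mult.assoc[symmetric] density)
    then show ?thesis
      by (rule has_bochner_integral_bounded_linear[OF bounded_linear_of_real])
  qed
  show "has_bochner_integral lborel (\<lambda>t. complex_of_real (exp (- (a * t\<^sup>2)))) (sqrt (pi / a))"
    using lift[of 0 1] normal_moment_even[OF \<sigma>(1), of 0 0] by simp
  show "has_bochner_integral lborel (\<lambda>t. complex_of_real (exp (- (a * t\<^sup>2)) * t)) 0"
    using lift[of 1 0] normal_moment_odd[OF \<sigma>(1), of 0 0] by simp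
  show "has_bochner_integral lborel (\<lambda>t. complex_of_real (exp (- (a * t\<^sup>2)) * t\<^sup>2))
      (sqrt (pi / a) / (2 * a))"
  proof -
    have "has_bochner_integral lborel (\<lambda>t. normal_density 0 \<sigma> t * t\<^sup>2) (1 / (2 * a))"
      using normal_moment_even[OF \<sigma>(1), of 0 1] by (simp add: \<sigma>(2))
    from lift[OF this] show ?thesis by simp
  qed
qed

section \<open>Real coordinates of a Hermitian matrix\<close>

definition upper_pairs :: "nat \<Rightarrow> (nat \<times> nat) set" where
  "upper_pairs N = {(i, j). i < j \<and> j < N}"

lemma upper_pairs_subset: "upper_pairs N \<subseteq> {..<N} \<times> {..<N}"
  by (auto simp: upper_pairs_def)

lemma finite_upper_pairs [simp]: "finite (upper_pairs N)"
  by (rule finite_subset[OF upper_pairs_subset]) simp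

text \<open>The square is the diagonal, the part above it and the mirror image of that part. Working
  in any commutative monoid serves both the sum in the exponent and the products of factors.\<close>

lemma (in comm_monoid_set) square_split:
  fixes N :: nat
  shows "F g ({..<N} \<times> {..<N}) = f (F (\<lambda>i. g (i, i)) {..<N})
    (F (\<lambda>u. f (g u) (g (prod.swap u))) (upper_pairs N))"
proof -
  let ?U = "upper_pairs N" and ?D = "(\<lambda>i. (i, i)) ` {..<N}"
  have "{..<N} \<times> {..<N} = ?D \<union> (?U \<union> prod.swap ` ?U)"
    by (force simp: upper_pairs_def image_iff)
  moreover have "?D \<inter> (?U \<union> prod.swap ` ?U) = {}" "?U \<inter> prod.swap ` ?U = {}"
    by (auto simp: upper_pairs_def)
  ultimately have "F g ({..<N} \<times> {..<N}) = f (F g ?D) (f (F g ?U) (F g (prod.swap ` ?U)))"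
    by (simp add: union_disjoint)
  moreover have "F g ?D = F (\<lambda>i. g (i, i)) {..<N}"
    by (subst reindex) (auto simp: inj_on_def comp_def)
  moreover have "F g (prod.swap ` ?U) = F (\<lambda>u. g (prod.swap u)) ?U"
    by (subst reindex) (auto simp: comp_def)
  ultimately show ?thesis
    by (simp add: distrib)
qed

lemma herm_of_coords_upper:
  assumes "u \<in> upper_pairs N"
  shows "herm_of_coords N x $$ u = complex_of_real (x u) + \<i> * complex_of_real (x (prod.swap u))"
    and "herm_of_coords N x $$ prod.swap u =
      complex_of_real (x u) - \<i> * complex_of_real (x (prod.swap u))"
  using assms by (auto simp: upper_pairs_def herm_of_coords_def complex_eq_iff)

text \<open>The coefficient of \<open>(x p)^2\<close> in \<open>N * Tr (M^2) / 2\<close>: a diagonal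
  entry enters the trace once, the square of an off-diagonal coordinate twice, from
  \<open>M_ij M_ji\<close> and \<open>M_ji M_ij\<close>.\<close>

definition gauss_rate :: "nat \<Rightarrow> nat \<times> nat \<Rightarrow> real" where
  "gauss_rate N p = (if fst p = snd p then real N / 2 else real N)"

lemma gauss_weight_coords:
  "gauss_weight N (herm_of_coords N x) =
    (\<Prod>p\<in>{..<N} \<times> {..<N}. complex_of_real (exp (- (gauss_rate N p * (x p)\<^sup>2))))"
proof -
  let ?M = "herm_of_coords N x" and ?I = "{..<N} \<times> {..<N}"
  have M: "?M \<in> carrier_mat N N"
    by (simp add: herm_of_coords_def)
  have "mat_trace ((1 / 2) \<cdot>\<^sub>m (?M * ?M)) = (\<Sum>i<N. \<Sum>j<N. 1 / 2 * (?M $$ (i, j) * ?M $$ (j, i)))"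
    using M by (simp add: mat_trace_def scalar_prod_def lessThan_atLeast0 sum_distrib_left)
  also have "\<dots> = (\<Sum>p\<in>?I. 1 / 2 * (?M $$ p * ?M $$ prod.swap p))"
    by (simp add: sum.cartesian_product case_prod_beta prod.swap_def)
  finally have "of_nat N * mat_trace ((1 / 2) \<cdot>\<^sub>m (?M * ?M)) =
      (\<Sum>p\<in>?I. of_nat N / 2 * (?M $$ p * ?M $$ prod.swap p))"
    by (simp add: sum_distrib_left)
  also have "\<dots> = (\<Sum>p\<in>?I. complex_of_real (gauss_rate N p * (x p)\<^sup>2))"
    unfolding sum.square_split
  proof (rule arg_cong2[of _ _ _ _ "(+)"]; rule sum.cong[OF refl])
    fix i assume "i \<in> {..<N}"
    then show "of_nat N / 2 * (?M $$ (i, i) * ?M $$ prod.swap (i, i)) =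
        complex_of_real (gauss_rate N (i, i) * (x (i, i))\<^sup>2)"
      by (simp add: gauss_rate_def herm_of_coords_def power2_eq_square)
  next
    fix u assume u: "u \<in> upper_pairs N"
    have "fst u \<noteq> snd u"
      using u by (auto simp: upper_pairs_def)
    then show "of_nat N / 2 * (?M $$ u * ?M $$ prod.swap u) +
        of_nat N / 2 * (?M $$ prod.swap u * ?M $$ prod.swap (prod.swap u)) =
        complex_of_real (gauss_rate N u * (x u)\<^sup>2) +
        complex_of_real (gauss_rate N (prod.swap u) * (x (prod.swap u))\<^sup>2)"
      by (simp add: gauss_rate_def herm_of_coords_upper[OF u] power2_eq_square algebra_simps)
  qed
  finally show ?thesis
    unfolding gauss_weight_def
    by (simp add: exp_sum flip: sum_negf exp_of_real)
qed

text \<open>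
  For \<open>u = (i, j)\<close> with \<open>i < j\<close>, the contribution \<open>1\<close>, \<open>M\<^sub>i\<^sub>j = x + \<i>y\<close>, \<open>M\<^sub>j\<^sub>i = x - \<i>y\<close> or
  \<open>M\<^sub>i\<^sub>j M\<^sub>j\<^sub>i = x\<^sup>2 + y\<^sup>2\<close> of \<open>q \<inter> {u, prod.swap u}\<close> is a sum over \<open>s\<close> of two products of a function of
  \<open>x\<close> and a function of \<open>y\<close>: the term \<open>s = True\<close> carries \<open>x\<close> and the term \<open>s = False\<close> carries \<open>y\<close>.
  The function of the coordinate at \<open>p\<close> is \<open>coord_factor q s p\<close>.
\<close>

definition coord_factor :: "(nat \<times> nat) set \<Rightarrow> bool \<Rightarrow> nat \<times> nat \<Rightarrow> real \<Rightarrow> complex" where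
  "coord_factor q s p t =
    (if fst p = snd p then 1
     else if p \<in> q \<and> prod.swap p \<in> q then (if s = (fst p < snd p) then of_real (t\<^sup>2) else 1)
     else if p \<notin> q \<and> prod.swap p \<notin> q then (if fst p < snd p \<and> \<not> s then 0 else 1)
     else if s = (fst p < snd p)
       then (if s then 1 else if p \<in> q then - \<i> else \<i>) * of_real t
     else 1)"

text \<open>The integrals of \<open>coord_factor\<close> against the one-dimensional Gaussians. Off
  the diagonal the rate is \<open>N\<close>, so the second moment relative to the total mass is
  \<open>1 / (2 * N)\<close>.\<close>

definition coord_moment :: "nat \<Rightarrow> (nat \<times> nat) set \<Rightarrow> bool \<Rightarrow> nat \<times> nat \<Rightarrow> complex" where
  "coord_moment N q s p = complex_of_real (sqrt (pi / gauss_rate N p)) *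
    (if fst p = snd p then 1
     else if p \<in> q \<and> prod.swap p \<in> q then (if s = (fst p < snd p) then 1 / (2 * of_nat N) else 1)
     else if p \<notin> q \<and> prod.swap p \<notin> q then (if fst p < snd p \<and> \<not> s then 0 else 1)
     else if s = (fst p < snd p) then 0
     else 1)"

lemma has_bochner_integral_coord:
  assumes "N \<ge> 1"
  shows "has_bochner_integral lborel
    (\<lambda>t. complex_of_real (exp (- (gauss_rate N p * t\<^sup>2))) * coord_factor q s p t)
    (coord_moment N q s p)"
proof -
  have r: "gauss_rate N p > 0"
    using assms by (simp add: gauss_rate_def)
  note m = gaussian_moments[OF r]
  have m1: "has_bochner_integral lborel
      (\<lambda>t. complex_of_real (exp (- (gauss_rate N p * t\<^sup>2))) * (c * complex_of_real t)) 0" for c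
    using has_bochner_integral_mult_right[OF m(2), of c] by (simp add: ac_simps)
  have m2: "has_bochner_integral lborel
      (\<lambda>t. complex_of_real (exp (- (gauss_rate N p * t\<^sup>2))) * complex_of_real (t\<^sup>2))
      (complex_of_real (sqrt (pi / gauss_rate N p)) * (1 / (2 * of_nat N)))" if "fst p \<noteq> snd p"
    using m(3) that by (simp add: gauss_rate_def)
  show ?thesis
    unfolding coord_factor_def coord_moment_def
    using m(1) m1 m2 by (auto simp: has_bochner_integral_zero)
qed

text \<open>Filling up the product over \<open>q\<close> with ones and grouping opposite arcs leaves
  one factor per unordered pair. Its form as a sum of products prepares integration one coordinate
  at a time.\<close>

lemma prod_herm_of_coords:
  assumes "q \<subseteq> {..<N} \<times> {..<N}" "\<And>i. (i, i) \<notin> q"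
  shows "(\<Prod>e\<in>q. herm_of_coords N x $$ e) = (\<Prod>u\<in>upper_pairs N.
    \<Sum>s\<in>UNIV. coord_factor q s u (x u) * coord_factor q s (prod.swap u) (x (prod.swap u)))"
proof -
  let ?M = "herm_of_coords N x" and ?I = "{..<N} \<times> {..<N}"
  have "(\<Prod>e\<in>q. ?M $$ e) = (\<Prod>e\<in>?I. if e \<in> q then ?M $$ e else 1)"
    using prod.inter_restrict[of ?I "\<lambda>e. ?M $$ e" q] assms(1) by (simp add: Int_absorb1)
  also have "\<dots> = (\<Prod>u\<in>upper_pairs N. (if u \<in> q then ?M $$ u else 1) *
      (if prod.swap u \<in> q then ?M $$ prod.swap u else 1))"
    unfolding prod.square_split using assms(2) by simp
  also have "\<dots> = (\<Prod>u\<in>upper_pairs N.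
      \<Sum>s\<in>UNIV. coord_factor q s u (x u) * coord_factor q s (prod.swap u) (x (prod.swap u)))"
  proof (rule prod.cong[OF refl])
    fix u assume u: "u \<in> upper_pairs N"
    then have "fst u < snd u"
      by (auto simp: upper_pairs_def)
    then show "(if u \<in> q then ?M $$ u else 1) * (if prod.swap u \<in> q then ?M $$ prod.swap u else 1) =
      (\<Sum>s\<in>UNIV. coord_factor q s u (x u) * coord_factor q s (prod.swap u) (x (prod.swap u)))"
      by (auto simp: UNIV_bool coord_factor_def herm_of_coords_upper[OF u] power2_eq_square
          algebra_simps)
  qed
  finally show ?thesis .
qed

text \<open>Sends both coordinates of a pair to its representative above the diagonal, where the
  choice \<open>s\<close> is made. On the diagonal any value will do, as \<open>coord_factor\<close>
  does not depend on \<open>s\<close> there.\<close>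

definition orient :: "nat \<times> nat \<Rightarrow> nat \<times> nat" where
  "orient p = (if fst p < snd p then p else prod.swap p)"

lemma orient_upper:
  "u \<in> upper_pairs N \<Longrightarrow> orient u = u" "u \<in> upper_pairs N \<Longrightarrow> orient (prod.swap u) = u"
  by (auto simp: upper_pairs_def orient_def)

text \<open>Multiplying out the two-term sums gives one term for each function
  \<open>\<sigma>\<close> that chooses a summand at every pair, and each term is a single product
  over all coordinates.\<close>

lemma weight_times_monomial:
  assumes "q \<subseteq> {..<N} \<times> {..<N}" "\<And>i. (i, i) \<notin> q"
  shows "gauss_weight N (herm_of_coords N x) * (\<Prod>e\<in>q. herm_of_coords N x $$ e) =
    (\<Sum>\<sigma> \<in> upper_pairs N \<rightarrow>\<^sub>E UNIV. \<Prod>p\<in>{..<N} \<times> {..<N}.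
      complex_of_real (exp (- (gauss_rate N p * (x p)\<^sup>2))) * coord_factor q (\<sigma> (orient p)) p (x p))"
  unfolding gauss_weight_coords prod_herm_of_coords[OF assms] prod.distrib
proof (subst prod_sum_PiE, simp, simp, subst sum_distrib_left, rule sum.cong[OF refl])
  fix \<sigma> :: "nat \<times> nat \<Rightarrow> bool"
  let ?w = "\<Prod>p\<in>{..<N} \<times> {..<N}. complex_of_real (exp (- (gauss_rate N p * (x p)\<^sup>2)))"
  have diag: "coord_factor q s (i, i) t = 1" for s i t
    by (simp add: coord_factor_def)
  have "(\<Prod>p\<in>{..<N} \<times> {..<N}. coord_factor q (\<sigma> (orient p)) p (x p)) =
      (\<Prod>u\<in>upper_pairs N. coord_factor q (\<sigma> u) u (x u) *
        coord_factor q (\<sigma> u) (prod.swap u) (x (prod.swap u)))"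
    by (simp add: prod.square_split diag orient_upper cong: prod.cong)
  then show "?w * (\<Prod>u\<in>upper_pairs N. coord_factor q (\<sigma> u) u (x u) *
        coord_factor q (\<sigma> u) (prod.swap u) (x (prod.swap u))) =
      ?w * (\<Prod>p\<in>{..<N} \<times> {..<N}. coord_factor q (\<sigma> (orient p)) p (x p))"
    by simp
qed

text \<open>The mean of the contribution of the arcs \<open>u\<close> and \<open>prod.swap u\<close>
  to the monomial of \<open>q\<close>.\<close>

definition pair_moment :: "nat \<Rightarrow> (nat \<times> nat) set \<Rightarrow> nat \<times> nat \<Rightarrow> complex" where
  "pair_moment N q u =
    (if u \<in> q \<and> prod.swap u \<in> q then 1 / of_nat N else if u \<notin> q \<and> prod.swap u \<notin> q then 1 else 0)"

text \<open>For \<open>N \<ge> 1\<close> this is the value of \<open>gauss_Z0 N\<close>.\<close>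

definition gauss_norm :: "nat \<Rightarrow> complex" where
  "gauss_norm N = (\<Prod>p\<in>{..<N} \<times> {..<N}. complex_of_real (sqrt (pi / gauss_rate N p)))"

text \<open>After integration the expansion over \<open>\<sigma>\<close> is undone: the sum of
  products factors again over pairs. A pair with both arcs in \<open>q\<close> gets
  \<open>1 / (2 * N)\<close> twice; with exactly one arc in \<open>q\<close>, both summands contain
  a vanishing first moment.\<close>

lemma sum_prod_coord_moment:
  assumes "N \<ge> 1"
  shows "(\<Sum>\<sigma> \<in> upper_pairs N \<rightarrow>\<^sub>E UNIV. \<Prod>p\<in>{..<N} \<times> {..<N}. coord_moment N q (\<sigma> (orient p)) p) =
    gauss_norm N * (\<Prod>u\<in>upper_pairs N. pair_moment N q u)"
proof -
  let ?z = "\<lambda>p. complex_of_real (sqrt (pi / gauss_rate N p))"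
  have diag: "coord_moment N q s (i, i) = ?z (i, i)" for s i
    by (simp add: coord_moment_def)
  have pair: "(\<Sum>s\<in>UNIV. coord_moment N q s u * coord_moment N q s (prod.swap u)) =
      ?z u * ?z (prod.swap u) * pair_moment N q u" if "u \<in> upper_pairs N" for u
  proof -
    have "fst u < snd u"
      using that by (auto simp: upper_pairs_def)
    then show ?thesis
      using assms by (auto simp: UNIV_bool coord_moment_def pair_moment_def field_simps)
  qed
  have "(\<Sum>\<sigma> \<in> upper_pairs N \<rightarrow>\<^sub>E UNIV. \<Prod>p\<in>{..<N} \<times> {..<N}. coord_moment N q (\<sigma> (orient p)) p) =
      (\<Prod>i<N. ?z (i, i)) * (\<Sum>\<sigma> \<in> upper_pairs N \<rightarrow>\<^sub>E UNIV. \<Prod>u\<in>upper_pairs N.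
        coord_moment N q (\<sigma> u) u * coord_moment N q (\<sigma> u) (prod.swap u))"
    by (simp add: prod.square_split sum_distrib_left orient_upper diag cong: prod.cong)
  also have "\<dots> = (\<Prod>i<N. ?z (i, i)) *
      (\<Prod>u\<in>upper_pairs N. ?z u * ?z (prod.swap u) * pair_moment N q u)"
    by (subst prod_sum_PiE[symmetric]) (simp_all add: pair)
  finally show ?thesis
    by (simp add: gauss_norm_def prod.square_split prod.distrib)
qed

text \<open>Every term of the expansion is a product of functions of single coordinates, so Fubini
  turns its integral into a product of one-dimensional ones.\<close>

lemma has_bochner_integral_monomial:
  assumes N: "N \<ge> 1" and q: "q \<subseteq> {..<N} \<times> {..<N}" "\<And>i. (i, i) \<notin> q"
  shows "has_bochner_integral (\<Pi>\<^sub>M p \<in> {..<N} \<times> {..<N}. (lborel :: real measure))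
    (\<lambda>x. gauss_weight N (herm_of_coords N x) * (\<Prod>e\<in>q. herm_of_coords N x $$ e))
    (gauss_norm N * (\<Prod>u\<in>upper_pairs N. pair_moment N q u))"
  unfolding weight_times_monomial[OF q] sum_prod_coord_moment[OF N, symmetric]
proof (rule has_bochner_integral_sum)
  interpret product_sigma_finite "\<lambda>_ :: nat \<times> nat. lborel :: real measure"
    by standard
  fix \<sigma> :: "nat \<times> nat \<Rightarrow> bool"
  note int = has_bochner_integral_coord[OF N]
  show "has_bochner_integral (\<Pi>\<^sub>M p \<in> {..<N} \<times> {..<N}. (lborel :: real measure))
      (\<lambda>x. \<Prod>p\<in>{..<N} \<times> {..<N}. complex_of_real (exp (- (gauss_rate N p * (x p)\<^sup>2))) *
        coord_factor q (\<sigma> (orient p)) p (x p))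
      (\<Prod>p\<in>{..<N} \<times> {..<N}. coord_moment N q (\<sigma> (orient p)) p)"
    unfolding has_bochner_integral_iff
  proof
    show "integrable (\<Pi>\<^sub>M p \<in> {..<N} \<times> {..<N}. (lborel :: real measure))
      (\<lambda>x. \<Prod>p\<in>{..<N} \<times> {..<N}. complex_of_real (exp (- (gauss_rate N p * (x p)\<^sup>2))) *
        coord_factor q (\<sigma> (orient p)) p (x p))"
      by (rule product_integrable_prod) (auto intro: integrable.intros int)
    show "(\<integral>x. (\<Prod>p\<in>{..<N} \<times> {..<N}. complex_of_real (exp (- (gauss_rate N p * (x p)\<^sup>2))) *
        coord_factor q (\<sigma> (orient p)) p (x p)) \<partial>(\<Pi>\<^sub>M p \<in> {..<N} \<times> {..<N}. (lborel :: real measure))) =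
      (\<Prod>p\<in>{..<N} \<times> {..<N}. coord_moment N q (\<sigma> (orient p)) p)"
      by (subst product_integral_prod)
         (auto intro: integrable.intros int simp: has_bochner_integral_integral_eq[OF int])
  qed
qed

section \<open>Means of monomials over Hermitian matrices\<close>

lemma has_bochner_integral_herm_lebesgue:
  fixes f :: "complex mat \<Rightarrow> complex"
  assumes "has_bochner_integral (\<Pi>\<^sub>M p \<in> {..<N} \<times> {..<N}. (lborel :: real measure))
    (\<lambda>x. f (herm_of_coords N x)) I"
  shows "has_bochner_integral (herm_lebesgue N) f I"
proof -
  let ?P = "\<Pi>\<^sub>M p \<in> {..<N} \<times> {..<N}. (lborel :: real measure)"
  have inj: "inj_on (herm_of_coords N) (space ?P)"
    using bij_betw_herm_of_coords by (rule bij_betw_imp_inj_on)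
  have f: "f \<in> borel_measurable (embed_measure ?P (herm_of_coords N))"
    using assms by (intro measurable_embed_measure1) (auto elim: has_bochner_integral.cases)
  \<comment> \<open>Injectivity of the coordinate map makes the embedded measure an image measure,
    so this is a change of variables.\<close>
  have "has_bochner_integral (distr ?P (embed_measure ?P (herm_of_coords N)) (herm_of_coords N))
      f I"
    by (rule has_bochner_integral_distr[OF f measurable_embed_measure2'[OF inj] assms])
  then show ?thesis
    unfolding herm_lebesgue_def by (subst embed_measure_eq_distr'[OF inj])
qed

text \<open>The index set \<open>A\<close> is arbitrary because an arc set occurs once for each of
  its partitions into cycles. The normalisation is the case of the empty monomial.\<close>

lemma gauss_mean_sum_monomials:
  assumes N: "N \<ge> 1" and q: "\<And>a. a \<in> A \<Longrightarrow> q a \<subseteq> {..<N} \<times> {..<N}"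
    "\<And>a i. a \<in> A \<Longrightarrow> (i, i) \<notin> q a"
  shows "gauss_mean N (\<lambda>M. \<Sum>a\<in>A. \<Prod>e\<in>q a. M $$ e) =
    (\<Sum>a\<in>A. \<Prod>u\<in>upper_pairs N. pair_moment N (q a) u)"
proof -
  have "has_bochner_integral (herm_lebesgue N) (gauss_weight N) (gauss_norm N)"
    using has_bochner_integral_herm_lebesgue[of N "gauss_weight N" "gauss_norm N"]
      has_bochner_integral_monomial[OF N, of "{}"]
    by (simp add: pair_moment_def)
  then have Z: "gauss_Z0 N = gauss_norm N"
    by (simp add: gauss_Z0_def has_bochner_integral_integral_eq)
  have "gauss_norm N \<noteq> 0"
    using N by (simp add: gauss_norm_def gauss_rate_def)
  moreover have "has_bochner_integral (herm_lebesgue N)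
      (\<lambda>M. \<Sum>a\<in>A. gauss_weight N M * (\<Prod>e\<in>q a. M $$ e))
      (\<Sum>a\<in>A. gauss_norm N * (\<Prod>u\<in>upper_pairs N. pair_moment N (q a) u))"
    using q by (intro has_bochner_integral_sum has_bochner_integral_herm_lebesgue
        has_bochner_integral_monomial[OF N])
  ultimately show ?thesis
    unfolding gauss_mean_def Z
    by (simp add: sum_distrib_left[symmetric] has_bochner_integral_integral_eq)
qed

text \<open>An arc without its opposite leaves a pair of mean 0. For symmetric \<open>q\<close>
  every pair inside \<open>q\<close> gives \<open>1 / N\<close>, and
  \<open>q \<inter> upper_pairs N\<close> counts these pairs.\<close>

lemma prod_pair_moment:
  assumes "q \<subseteq> {..<N} \<times> {..<N}" "\<And>i. (i, i) \<notin> q"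
  shows "(\<Prod>u\<in>upper_pairs N. pair_moment N q u) =
    (if sym q then 1 / of_nat N ^ card (q \<inter> upper_pairs N) else 0)"
proof (cases "sym q")
  case True
  then have "pair_moment N q u = (if u \<in> q then 1 / of_nat N else 1)" for u
    by (cases u) (auto simp: pair_moment_def dest: symD)
  then have "(\<Prod>u\<in>upper_pairs N. pair_moment N q u) = (\<Prod>u\<in>upper_pairs N \<inter> q. 1 / of_nat N)"
    by (simp only: prod.inter_restrict[OF finite_upper_pairs])
  then show ?thesis
    using True by (simp add: power_divide Int_commute)
next
  case False
  then obtain i j where ij: "(i, j) \<in> q" "(j, i) \<notin> q"
    by (auto simp: sym_def)
  let ?u = "orient (i, j)"
  have "i \<noteq> j" "i < N" "j < N"
    using ij(1) assms by auto
  then have "?u \<in> upper_pairs N"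
    by (auto simp: orient_def upper_pairs_def)
  moreover have "pair_moment N q ?u = 0"
    using ij by (auto simp: orient_def pair_moment_def)
  ultimately have "(\<Prod>u\<in>upper_pairs N. pair_moment N q u) = 0"
    by (intro prod_zero) auto
  then show ?thesis
    using False by simp
qed

section \<open>Directed cycle double covers as partitions of the arcs\<close>

lemma dicycle_iff: "dicycle A k c \<longleftrightarrow> dicycle UNIV k c \<and> c \<subseteq> A"
  by (auto simp: dicycle_def)

lemma dicycle_nonempty: "dicycle A k c \<Longrightarrow> c \<noteq> {}"
  unfolding dicycle_def by (metis length_0_conv length_rotate1 length_zip min.idem set_empty)

lemma dicycle_arcE:
  assumes "distinct vs" "(x, y) \<in> set (zip vs (rotate1 vs))"
  obtains i where "i < length vs" "x = vs ! i" "y = vs ! (Suc i mod length vs)"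
  using assms by (auto simp: in_set_zip nth_rotate1)

text \<open>With opposite arcs, each of two positions would directly follow the other modulo the
  length, which forces length at most 2. The case \<open>x = y\<close> excludes loops.\<close>

lemma dicycle_no_opposite:
  assumes "dicycle A k c" "k \<ge> 3" "(x, y) \<in> c"
  shows "(y, x) \<notin> c"
proof
  assume yx: "(y, x) \<in> c"
  obtain vs where vs: "length vs = k" "distinct vs" "c = set (zip vs (rotate1 vs))"
    using assms(1) by (auto simp: dicycle_def)
  obtain i where i: "i < k" "x = vs ! i" "y = vs ! (Suc i mod k)"
    using assms(3) vs dicycle_arcE by metis
  obtain j where j: "j < k" "y = vs ! j" "x = vs ! (Suc j mod k)"
    using yx vs dicycle_arcE by metis
  have "j = Suc i mod k" "i = Suc j mod k"
    using i j vs(1,2) assms(2) by (simp_all add: nth_eq_iff_index_eq)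
  then show False
    using i(1) j(1) assms(2) by (auto simp: mod_Suc split: if_splits)
qed

text \<open>The vertices of the cycle are the sources of its arcs, so they lie in \<open>S\<close>
  and \<open>f\<close> keeps them distinct.\<close>

lemma dicycle_image:
  assumes "dicycle A k c" "inj_on f S" "c \<subseteq> S \<times> S"
  shows "dicycle (map_prod f f ` A) k (map_prod f f ` c)"
proof -
  obtain vs where vs: "vs \<noteq> []" "length vs = k" "distinct vs" "c = set (zip vs (rotate1 vs))" "c \<subseteq> A"
    using assms(1) by (auto simp: dicycle_def)
  have "set vs = fst ` c"
    unfolding vs(4) set_map[symmetric] by simp
  then have "inj_on f (set vs)"
    using assms(2,3) by (force intro: inj_on_subset)
  moreover have "map_prod f f ` c = set (zip (map f vs) (rotate1 (map f vs)))"
    unfolding vs(4) rotate1_map zip_map_map set_map by (simp add: map_prod_def)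
  moreover have "map_prod f f ` c \<subseteq> map_prod f f ` A"
    using vs(5) by blast
  ultimately show ?thesis
    unfolding dicycle_def using vs by (intro exI[of _ "map f vs"]) (auto simp: distinct_map)
qed

definition arcs :: "'a set set \<Rightarrow> ('a \<times> 'a) set" where
  "arcs E = {(x, y). {x, y} \<in> E}"

lemma oriented_cycle_iff: "oriented_cycle E c \<longleftrightarrow> (\<exists>k\<ge>3. dicycle (arcs E) k c)"
  by (simp add: oriented_cycle_def arcs_def)

text \<open>That exactly one cycle passes through each arc means that the cycles partition the arcs.
  This form matches \<open>cycle_partitions\<close>.\<close>

lemma is_DCDC_iff:
  "is_DCDC E C \<longleftrightarrow> partition_on (arcs E) C \<and> (\<forall>c\<in>C. oriented_cycle E c)"
proof
  assume C: "is_DCDC E C"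
  have sub: "c \<subseteq> arcs E" "c \<noteq> {}" if "c \<in> C" for c
    using C that dicycle_nonempty
    by (fastforce simp: is_DCDC_def oriented_cycle_def dicycle_def arcs_def)+
  have ex1: "\<exists>!c. c \<in> C \<and> (x, y) \<in> c" if "(x, y) \<in> arcs E" for x y
    using C that by (auto simp: is_DCDC_def arcs_def)
  have "partition_on (arcs E) C"
  proof (rule partition_onI)
    show "\<Union>C = arcs E"
      using sub ex1 by fast
    show "disjnt c d" if "c \<in> C" "d \<in> C" "c \<noteq> d" for c d
      using that sub ex1 unfolding disjnt_iff by fast
    show "{} \<notin> C"
      using sub by blast
  qed
  then show "partition_on (arcs E) C \<and> (\<forall>c\<in>C. oriented_cycle E c)"
    using C by (simp add: is_DCDC_def)
next
  assume C: "partition_on (arcs E) C \<and> (\<forall>c\<in>C. oriented_cycle E c)"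
  then have un: "\<Union>C = arcs E" and dis: "disjoint C"
    by (auto simp: partition_on_def)
  have ex1: "\<exists>!c. c \<in> C \<and> (x, y) \<in> c" if "{x, y} \<in> E" for x y
  proof -
    have "(x, y) \<in> \<Union>C"
      using that un by (simp add: arcs_def)
    then show ?thesis
      using dis by (auto simp: disjoint_def)
  qed
  have "card {c \<in> C. (x, y) \<in> c \<or> (y, x) \<in> c} = 2" if xy: "{x, y} \<in> E" for x y
  proof -
    obtain c where c: "c \<in> C" "(x, y) \<in> c" "\<And>d. d \<in> C \<Longrightarrow> (x, y) \<in> d \<Longrightarrow> d = c"
      using ex1[OF xy] by blast
    obtain d where d: "d \<in> C" "(y, x) \<in> d" "\<And>c. c \<in> C \<Longrightarrow> (y, x) \<in> c \<Longrightarrow> c = d"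
      using ex1[of y x] xy by (metis insert_commute)
    \<comment> \<open>A cycle of length at least three has no opposite arcs, so the two directions
      of the edge use different cycles, which makes the count exactly two.\<close>
    have "c \<noteq> d"
      using C c d dicycle_no_opposite by (metis oriented_cycle_def)
    moreover have "{c \<in> C. (x, y) \<in> c \<or> (y, x) \<in> c} = {c, d}"
      using c d by blast
    ultimately show ?thesis by simp
  qed
  moreover have "\<exists>!c. c \<in> C \<and> (y, x) \<in> c" if "{x, y} \<in> E" for x y
    using that by (intro ex1) (simp only: insert_commute)
  ultimately show "is_DCDC E C"
    unfolding is_DCDC_def using C ex1 by blast
qed

text \<open>An edge gives both of its orientations as arcs, so an arc on the image of an edge lifts
  in whichever order it is read.\<close>

lemma arcs_image:
  assumes "simple_graph V E"
  shows "arcs ((\<lambda>e. f ` e) ` E) = map_prod f f ` arcs E"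
proof
  show "arcs ((\<lambda>e. f ` e) ` E) \<subseteq> map_prod f f ` arcs E"
  proof
    fix p assume "p \<in> arcs ((\<lambda>e. f ` e) ` E)"
    then obtain u v e where p: "p = (u, v)" and e: "e \<in> E" "{u, v} = f ` e"
      by (auto simp: arcs_def)
    obtain x y where xy: "e = {x, y}"
      using assms e(1) by (auto simp: simple_graph_def)
    then have "(u, v) = (f x, f y) \<or> (u, v) = (f y, f x)"
      using e(2) by (auto simp: doubleton_eq_iff)
    moreover have "(x, y) \<in> arcs E" "(y, x) \<in> arcs E"
      using e(1) xy by (auto simp: arcs_def insert_commute)
    ultimately show "p \<in> map_prod f f ` arcs E"
      using p by force
  qed
  show "map_prod f f ` arcs E \<subseteq> arcs ((\<lambda>e. f ` e) ` E)"
  proof (clarsimp simp: arcs_def)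
    fix x y assume "{x, y} \<in> E"
    then show "{f x, f y} \<in> (\<lambda>e. f ` e) ` E"
      by (intro image_eqI[of _ _ "{x, y}"]) auto
  qed
qed

lemma arcs_subset:
  assumes "simple_graph V E"
  shows "arcs E \<subseteq> V \<times> V"
  using assms by (fastforce simp: simple_graph_def arcs_def doubleton_eq_iff)

text \<open>\<open>iso_via\<close> by itself does not ask its target to be a cover; this makes
  relabelled copies covers again.\<close>

lemma DCDC_pairs_iso:
  assumes P: "P \<in> DCDC_pairs N" and f: "iso_via f P Q"
  shows "Q \<in> DCDC_pairs N"
proof -
  obtain V E C where PV: "P = (V, E, C)" by (cases P)
  let ?E = "(\<lambda>e. f ` e) ` E" and ?C = "(\<lambda>c. map_prod f f ` c) ` C"
  have QV: "Q = (f ` V, ?E, ?C)" and inj: "inj_on f V"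
    using f PV by (cases Q; auto simp: bij_betw_def)+
  have G: "simple_graph V E" "card V \<le> N" "no_isolated_vertex V E"
    and C: "partition_on (arcs E) C" "\<forall>c\<in>C. oriented_cycle E c"
    using P by (auto simp: PV DCDC_pairs_def is_DCDC_iff)
  have "\<exists>x\<in>f ` V. \<exists>y\<in>f ` V. x \<noteq> y \<and> f ` e = {x, y}" if e: "e \<in> E" for e
  proof -
    obtain x y where "x \<in> V" "y \<in> V" "x \<noteq> y" "e = {x, y}"
      using G(1) e by (auto simp: simple_graph_def)
    then show ?thesis
      using inj by (intro bexI[of _ "f x"] bexI[of _ "f y"]) (auto simp: inj_on_eq_iff)
  qed
  then have "simple_graph (f ` V) ?E"
    using G(1) by (simp add: simple_graph_def)
  moreover have "card (f ` V) \<le> N"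
    using G(2) inj by (simp add: card_image)
  moreover have "no_isolated_vertex (f ` V) ?E"
    using G(3) by (fastforce simp: no_isolated_vertex_def)
  moreover have "partition_on (arcs ?E) ?C"
  proof -
    have "inj_on (map_prod f f) (arcs E)"
      using map_prod_inj_on[OF inj inj] arcs_subset[OF G(1)] by (rule inj_on_subset)
    from partition_on_inj_image[OF C(1) this] show ?thesis
      unfolding arcs_image[OF G(1)] using partition_onD3[OF C(1)] by (simp add: image_iff)
  qed
  moreover have "\<forall>c\<in>?C. oriented_cycle ?E c"
  proof safe
    fix c assume c: "c \<in> C"
    then obtain k where k: "k \<ge> 3" "dicycle (arcs E) k c"
      using C(2) by (auto simp: oriented_cycle_iff)
    have "c \<subseteq> V \<times> V"
      using k(2)[unfolded dicycle_iff[of "arcs E"]] arcs_subset[OF G(1)] by blast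
    from dicycle_image[OF k(2) inj this] show "oriented_cycle ?E (map_prod f f ` c)"
      using k(1) by (auto simp: oriented_cycle_iff arcs_image[OF G(1)])
  qed
  ultimately show ?thesis
    by (simp add: QV DCDC_pairs_def is_DCDC_iff)
qed

section \<open>Counting labelled copies\<close>

fun image_cover :: "('a \<Rightarrow> 'b) \<Rightarrow> 'a graph_cover \<Rightarrow> 'b graph_cover" where
  "image_cover f (V, E, C) = (f ` V, (\<lambda>e. f ` e) ` E, (\<lambda>c. map_prod f f ` c) ` C)"

text \<open>An isomorphism determines its target, so the labelled copies of \<open>P\<close> can be
  counted through injections of its vertex set.\<close>

lemma iso_via_iff_image: "iso_via f P Q \<longleftrightarrow> inj_on f (fst P) \<and> Q = image_cover f P"
  by (cases P; cases Q) (auto simp: bij_betw_def)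

text \<open>The isomorphisms onto a fixed isomorphic copy form a torsor under the automorphism group.\<close>

lemma card_isos_eq_card_Aut:
  assumes wf: "wf_cover P" and g: "iso_via g P Q"
  shows "card {f \<in> extensional (fst P). iso_via f P Q} = card (Aut P)"
proof -
  let ?V = "fst P"
  have inj: "inj_on g ?V"
    using g by (simp add: iso_via_iff_image)
  have "bij_betw (\<lambda>a. restrict (g \<circ> a) ?V) (Aut P) {f \<in> extensional ?V. iso_via f P Q}"
  proof (rule bij_betw_imageI)
    show "inj_on (\<lambda>a. restrict (g \<circ> a) ?V) (Aut P)"
    proof (rule inj_onI, rule ext)
      fix a b v
      assume ab: "a \<in> Aut P" "b \<in> Aut P" and eq: "restrict (g \<circ> a) ?V = restrict (g \<circ> b) ?V"
      have p: "a permutes ?V" "b permutes ?V"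
        using ab by (auto simp: Aut_def)
      show "a v = b v"
      proof (cases "v \<in> ?V")
        case True
        then have "g (a v) = g (b v)"
          using fun_cong[OF eq, of v] by simp
        then show ?thesis
          using inj p True by (meson inj_on_eq_iff permutes_in_image)
      qed (use p in \<open>simp add: permutes_def\<close>)
    qed
    show "(\<lambda>a. restrict (g \<circ> a) ?V) ` Aut P = {f \<in> extensional ?V. iso_via f P Q}"
    proof safe
      fix a assume "a \<in> Aut P"
      then have "iso_via (g \<circ> a) P Q"
        using g by (auto simp: Aut_def intro: iso_via_comp)
      then show "iso_via (restrict (g \<circ> a) ?V) P Q"
        using iso_via_cong[OF wf, of "restrict (g \<circ> a) ?V" "g \<circ> a" Q] by simp
    next
      fix f assume f: "f \<in> extensional ?V" "iso_via f P Q"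
      \<comment> \<open>The inverse of \<open>g\<close> after \<open>f\<close>, extended by the
        identity as \<open>permutes\<close> demands; composing it with \<open>g\<close> gives back
        \<open>f\<close>.\<close>
      let ?a = "\<lambda>v. if v \<in> ?V then inv_into ?V g (f v) else v"
      have "iso_via (inv_into ?V g \<circ> f) P P"
        using iso_via_comp[OF f(2) iso_via_inv[OF wf g]] .
      then have iso: "iso_via ?a P P"
        using iso_via_cong[OF wf, of ?a "inv_into ?V g \<circ> f" P] by simp
      then have "bij_betw ?a ?V ?V"
        by (cases P) simp
      then have "?a permutes ?V"
        by (rule bij_imp_permutes) simp
      then have a: "?a \<in> Aut P"
        using iso by (simp add: Aut_def)
      have "f = restrict (g \<circ> ?a) ?V"
      proof
        fix v
        have "f ` ?V = g ` ?V"
          using f(2) g by (cases P; cases Q) (auto simp: bij_betw_def)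
        then have "g (inv_into ?V g (f v)) = f v" if "v \<in> ?V"
          using that by (metis f_inv_into_f imageI)
        then show "f v = restrict (g \<circ> ?a) ?V v"
          using f(1) by (auto simp: extensional_def)
      qed
      then show "f \<in> (\<lambda>a. restrict (g \<circ> a) ?V) ` Aut P"
        using a by (rule image_eqI[of f "\<lambda>a. restrict (g \<circ> a) ?V" ?a])
    qed simp
  qed
  then show ?thesis
    by (rule bij_betw_same_card[symmetric])
qed

section \<open>Labelled copies and class weights\<close>

definition labelled_DCDC_pairs :: "nat \<Rightarrow> nat graph_cover set" where
  "labelled_DCDC_pairs N = {P \<in> DCDC_pairs N. fst P \<subseteq> {..<N}}"

lemma finite_labelled_DCDC_pairs: "finite (labelled_DCDC_pairs N)"
proof (rule finite_subset)
  show "labelled_DCDC_pairs N \<subseteq> Pow {..<N} \<times> Pow (Pow {..<N}) \<times> Pow (Pow ({..<N} \<times> {..<N}))"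
  proof
    fix P assume P: "P \<in> labelled_DCDC_pairs N"
    obtain V E C where PV: "P = (V, E, C)" by (cases P)
    have V: "V \<subseteq> {..<N}" and E: "\<forall>e\<in>E. e \<subseteq> V" and C: "\<forall>c\<in>C. c \<subseteq> V \<times> V"
      using P DCDC_pairs_wf[of P N] by (auto simp: labelled_DCDC_pairs_def wf_cover_def PV)
    have "E \<subseteq> Pow {..<N}" "C \<subseteq> Pow ({..<N} \<times> {..<N})"
      using E C V by (meson PowI Sigma_mono subsetI subset_trans)+
    then show "P \<in> Pow {..<N} \<times> Pow (Pow {..<N}) \<times> Pow (Pow ({..<N} \<times> {..<N}))"
      using V by (simp add: PV)
  qed
qed simp

text \<open>Group the injections of the vertex set into \<open>{..<N}\<close> by the copy they
  produce: the fibre over a copy consists of the isomorphisms onto it, and there are as many of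
  these as automorphisms.\<close>

lemma card_labelled_copies:
  assumes P: "P \<in> DCDC_pairs N"
  shows "card {Q \<in> labelled_DCDC_pairs N. iso_pairs P Q} * card (Aut P) =
    (\<Prod>i<card (fst P). N - i)"
proof -
  let ?F = "{f \<in> fst P \<rightarrow>\<^sub>E {..<N}. inj_on f (fst P)}"
  have wf: "wf_cover P"
    using P by (rule DCDC_pairs_wf)
  then have fin: "finite (fst P)"
    by (cases P) (simp add: wf_cover_def)
  have img: "(\<lambda>f. image_cover f P) ` ?F = {Q \<in> labelled_DCDC_pairs N. iso_pairs P Q}"
  proof (intro subset_antisym image_subsetI subsetI CollectI conjI; elim CollectE conjE)
    fix f assume f: "f \<in> fst P \<rightarrow>\<^sub>E {..<N}" "inj_on f (fst P)"
    then have iso: "iso_via f P (image_cover f P)"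
      by (simp add: iso_via_iff_image)
    then show "iso_pairs P (image_cover f P)"
      unfolding iso_pairs_def by (rule exI[of "\<lambda>g. iso_via g P (image_cover f P)"])
    have "fst (image_cover f P) \<subseteq> {..<N}"
      using f(1) by (cases P) auto
    then show "image_cover f P \<in> labelled_DCDC_pairs N"
      using DCDC_pairs_iso[OF P iso] by (simp add: labelled_DCDC_pairs_def)
  next
    fix Q assume Q: "Q \<in> labelled_DCDC_pairs N" "iso_pairs P Q"
    then obtain g where g: "iso_via g P Q"
      by (auto simp: iso_pairs_def)
    then have g': "iso_via (restrict g (fst P)) P Q"
      using iso_via_cong[OF wf, of "restrict g (fst P)" g Q] by simp
    have "g ` fst P \<subseteq> {..<N}"
      using Q(1) g by (cases P; cases Q) (auto simp: labelled_DCDC_pairs_def bij_betw_def)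
    then have "restrict g (fst P) \<in> ?F"
      using g' by (auto simp: iso_via_iff_image)
    then show "Q \<in> (\<lambda>f. image_cover f P) ` ?F"
      using g' by (intro rev_image_eqI) (auto simp: iso_via_iff_image)
  qed
  have fibre: "card {f. f \<in> ?F \<and> image_cover f P = Q} = card (Aut P)"
    if "Q \<in> (\<lambda>f. image_cover f P) ` ?F" for Q
  proof -
    have "fst Q \<subseteq> {..<N}" "iso_pairs P Q"
      using that img by (auto simp: labelled_DCDC_pairs_def)
    then obtain g where g: "iso_via g P Q"
      by (auto simp: iso_pairs_def)
    \<comment> \<open>On a fibre the range condition holds automatically, since the vertex set of
      \<open>Q\<close> lies in \<open>{..<N}\<close>.\<close>
    have pi: "f \<in> fst P \<rightarrow> {..<N}" if "image_cover f P = Q" for f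
    proof -
      have "f ` fst P = fst Q"
        unfolding that[symmetric] by (cases P) simp
      then show ?thesis
        using \<open>fst Q \<subseteq> {..<N}\<close> by blast
    qed
    have "{f. f \<in> ?F \<and> image_cover f P = Q} = {f \<in> extensional (fst P). iso_via f P Q}"
    proof (intro equalityI subsetI)
      fix f assume "f \<in> {f. f \<in> ?F \<and> image_cover f P = Q}"
      then show "f \<in> {f \<in> extensional (fst P). iso_via f P Q}"
        by (simp add: iso_via_iff_image PiE_def)
    next
      fix f assume f: "f \<in> {f \<in> extensional (fst P). iso_via f P Q}"
      then have Q: "image_cover f P = Q"
        by (simp add: iso_via_iff_image)
      show "f \<in> {f. f \<in> ?F \<and> image_cover f P = Q}"
        using f Q pi[OF Q] by (simp add: iso_via_iff_image PiE_def)
    qed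
    then show ?thesis
      using card_isos_eq_card_Aut[OF wf g] by simp
  qed
  have finF: "finite ?F"
    using fin by (simp add: finite_PiE)
  have "card ?F = (\<Sum>Q\<in>(\<lambda>f. image_cover f P) ` ?F. card {f. f \<in> ?F \<and> image_cover f P = Q})"
    using sum.image_gen[OF finF, of "\<lambda>_. 1::nat" "\<lambda>f. image_cover f P"] by simp
  also have "\<dots> = (\<Sum>Q\<in>(\<lambda>f. image_cover f P) ` ?F. card (Aut P))"
    by (rule sum.cong[OF refl fibre])
  also have "\<dots> = card {Q \<in> labelled_DCDC_pairs N. iso_pairs P Q} * card (Aut P)"
    unfolding img by simp
  finally have "card {Q \<in> labelled_DCDC_pairs N. iso_pairs P Q} * card (Aut P) = card ?F" ..
  also have "\<dots> = (\<Prod>i<card (fst P). N - i)"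
    unfolding card_inj_on_subset_funcset[OF fin finite_lessThan[of N] subset_refl] by (simp add: atLeast0LessThan)
  finally show ?thesis .
qed

text \<open>The weight of a class is its number of labelled copies divided by \<open>N\<close> to
  the number of edges, so the sum over classes regroups a sum over labelled covers.\<close>

lemma sum_class_weight:
  "(\<Sum>X \<in> DCDC_pairs N // iso_rel N. class_weight N X) =
    (\<Sum>(V, E, C) \<in> labelled_DCDC_pairs N. 1 / real N ^ card E)"
proof -
  let ?L = "labelled_DCDC_pairs N" and ?w = "\<lambda>(V, E, C). 1 / real N ^ card E"
  have cls: "class_weight N X = sum ?w {P \<in> ?L. iso_rel N `` {P} = X}"
    if X: "X \<in> DCDC_pairs N // iso_rel N" for X
  proof -
    obtain P where P: "P \<in> DCDC_pairs N" and XP: "X = iso_rel N `` {P}"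
      using X by (rule quotientE)
    obtain V E C where PV: "P = (V, E, C)" by (cases P)
    have "iso_rel N `` {Q} = X \<longleftrightarrow> iso_pairs P Q" if "Q \<in> ?L" for Q
    proof -
      have Q: "Q \<in> DCDC_pairs N"
        using that by (simp add: labelled_DCDC_pairs_def)
      have "iso_rel N `` {Q} = X \<longleftrightarrow> (P, Q) \<in> iso_rel N"
        using eq_equiv_class_iff[OF equiv_iso_rel P Q] XP by auto
      then show ?thesis
        using P Q by (simp add: iso_rel_def)
    qed
    then have eq: "{Q \<in> ?L. iso_rel N `` {Q} = X} = {Q \<in> ?L. iso_pairs P Q}"
      by blast
    have w: "?w Q = 1 / real N ^ card E" if PQ: "iso_pairs P Q" for Q
    proof -
      obtain f where f: "iso_via f P Q"
        using PQ by (auto simp: iso_pairs_def)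
      have "inj_on (\<lambda>e. f ` e) E"
        using f DCDC_pairs_wf[OF P] unfolding iso_via_iff_image
        by (intro inj_onI) (auto simp: PV wf_cover_def inj_on_image_eq_iff)
      then show ?thesis
        using f by (auto simp: iso_via_iff_image PV card_image)
    qed
    have aut: "card (Aut P) \<noteq> 0"
    proof -
      have "id \<in> Aut P"
        by (simp add: Aut_def iso_via_id permutes_id)
      moreover have "finite (Aut P)"
        using finite_permutations[of V] DCDC_pairs_wf[OF P]
        by (auto simp: Aut_def wf_cover_def PV elim: finite_subset[rotated])
      ultimately show ?thesis by auto
    qed
    have "card V \<le> N"
      using P by (simp add: PV DCDC_pairs_def)
    \<comment> \<open>Truncated subtraction agrees with real subtraction because
      \<open>i < card V \<le> N\<close>.\<close>
    then have "(\<Prod>i<card V. real N - real i) = real (\<Prod>i<card V. N - i)"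
      unfolding of_nat_prod by (intro prod.cong) auto
    also have "\<dots> = real (card {Q \<in> ?L. iso_pairs P Q}) * real (card (Aut P))"
      using card_labelled_copies[OF P] by (simp add: PV flip: of_nat_mult)
    finally have "pair_weight N P = real (card {Q \<in> ?L. iso_pairs P Q}) / real N ^ card E"
      using aut by (simp add: PV)
    also have "\<dots> = (\<Sum>Q\<in>{Q \<in> ?L. iso_pairs P Q}. 1 / real N ^ card E)"
      by simp
    also have "\<dots> = sum ?w {Q \<in> ?L. iso_pairs P Q}"
      by (rule sum.cong[OF refl], rule w[symmetric]) simp
    finally show ?thesis
      using class_weight_eq[OF X, of P] P equiv_class_self[OF equiv_iso_rel P] eq XP by simp
  qed
  have "(\<Sum>X \<in> DCDC_pairs N // iso_rel N. class_weight N X) =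
      (\<Sum>X \<in> DCDC_pairs N // iso_rel N. sum ?w {P \<in> ?L. iso_rel N `` {P} = X})"
    using cls by (rule sum.cong[OF refl])
  also have "\<dots> = sum ?w ?L"
    by (rule sum.group[OF finite_labelled_DCDC_pairs finite_iso_classes])
       (auto simp: labelled_DCDC_pairs_def intro: quotientI)
  finally show ?thesis .
qed

section \<open>Labelled covers and symmetric arc sets\<close>

text \<open>A loop would be its own opposite arc inside a cycle of length at least three.\<close>

lemma cycle_partitions_arcs:
  assumes "(q, K) \<in> cycle_partitions N"
  shows "q \<subseteq> {..<N} \<times> {..<N}" "(i, i) \<notin> q"
proof -
  show "q \<subseteq> {..<N} \<times> {..<N}"
    using assms by (simp add: cycle_partitions_def)
  have K: "partition_on q K" "\<And>c. c \<in> K \<Longrightarrow> \<exists>k\<ge>3. dicycle ({..<N} \<times> {..<N}) k c"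
    using assms by (auto simp: cycle_partitions_def)
  show "(i, i) \<notin> q"
    using K(2) dicycle_no_opposite unfolding partition_onD1[OF K(1)] by (metis UnionE)
qed

lemma finite_cycle_partitions: "finite (cycle_partitions N)"
proof (rule finite_subset)
  show "cycle_partitions N \<subseteq> Pow ({..<N} \<times> {..<N}) \<times> Pow (Pow ({..<N} \<times> {..<N}))"
    by (auto simp: cycle_partitions_def dest: partition_onD1)
qed simp

text \<open>The inverse of \<open>arcs\<close>, between symmetric loop-free arc sets and simple
  graphs.\<close>

definition edges_of_arcs :: "('a \<times> 'a) set \<Rightarrow> 'a set set" where
  "edges_of_arcs q = (\<lambda>(x, y). {x, y}) ` q"

lemma arcs_edges_of_arcs: "sym q \<Longrightarrow> arcs (edges_of_arcs q) = q"
  by (auto simp: arcs_def edges_of_arcs_def doubleton_eq_iff dest: symD)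

lemma edges_of_arcs_arcs:
  assumes "simple_graph V E"
  shows "edges_of_arcs (arcs E) = E"
  using assms by (fastforce simp: simple_graph_def arcs_def edges_of_arcs_def)

text \<open>Every vertex lies on an edge and so is the source of an arc. Thus the arcs determine the
  vertex set.\<close>

lemma fst_image_arcs:
  assumes "simple_graph V E" "no_isolated_vertex V E"
  shows "fst ` arcs E = V"
proof
  show "fst ` arcs E \<subseteq> V"
    using arcs_subset[OF assms(1)] by auto
  show "V \<subseteq> fst ` arcs E"
  proof
    fix v assume "v \<in> V"
    then obtain e where e: "e \<in> E" "v \<in> e"
      using assms(2) by (auto simp: no_isolated_vertex_def)
    then obtain x y where "e = {x, y}"
      using assms(1) by (auto simp: simple_graph_def)
    then obtain w where "{v, w} \<in> E"
      using e by (auto simp: insert_commute)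
    then have "(v, w) \<in> arcs E"
      by (simp add: arcs_def)
    then show "v \<in> fst ` arcs E"
      by force
  qed
qed

text \<open>Every edge has exactly one increasing orientation. This identifies the exponent of
  \<open>N\<close> with the number of edges.\<close>

lemma card_arcs_upper:
  assumes G: "simple_graph V E" and V: "V \<subseteq> {..<N}"
  shows "card (arcs E \<inter> upper_pairs N) = card E"
proof (rule bij_betw_same_card[of "\<lambda>(x, y). {x, y}"], rule bij_betw_imageI)
  show "inj_on (\<lambda>(x, y). {x, y}) (arcs E \<inter> upper_pairs N)"
    by (auto simp: inj_on_def upper_pairs_def doubleton_eq_iff)
  show "(\<lambda>(x, y). {x, y}) ` (arcs E \<inter> upper_pairs N) = E"
  proof
    show "(\<lambda>(x, y). {x, y}) ` (arcs E \<inter> upper_pairs N) \<subseteq> E"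
      by (auto simp: arcs_def)
    show "E \<subseteq> (\<lambda>(x, y). {x, y}) ` (arcs E \<inter> upper_pairs N)"
    proof
      fix e assume e: "e \<in> E"
      then obtain x y where xy: "x \<in> V" "y \<in> V" "x \<noteq> y" "e = {x, y}"
        using G by (auto simp: simple_graph_def)
      then have "e = {min x y, max x y}"
        by (auto simp: min_def max_def)
      moreover have "(min x y, max x y) \<in> upper_pairs N"
        using xy V by (auto simp: upper_pairs_def)
      ultimately show "e \<in> (\<lambda>(x, y). {x, y}) ` (arcs E \<inter> upper_pairs N)"
        using e by (intro image_eqI[of _ _ "(min x y, max x y)"]) (auto simp: arcs_def)
    qed
  qed
qed

text \<open>By symmetry every endpoint of an arc is also a source, so the sources form the vertex
  set of a graph without isolated vertices.\<close>

lemma labelled_cover_of_partition: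
  assumes qK: "(q, K) \<in> cycle_partitions N" and sym: "sym q"
  shows "(fst ` q, edges_of_arcs q, K) \<in> labelled_DCDC_pairs N"
proof -
  have q: "q \<subseteq> {..<N} \<times> {..<N}" and diag: "\<And>i. (i, i) \<notin> q"
    using cycle_partitions_arcs[OF qK] by auto
  have V: "fst ` q \<subseteq> {..<N}"
    using q by auto
  have "simple_graph (fst ` q) (edges_of_arcs q)"
    unfolding simple_graph_def
  proof (intro conjI ballI)
    show "finite (fst ` q)"
      using V finite_subset by blast
    fix e assume "e \<in> edges_of_arcs q"
    then obtain x y where xy: "(x, y) \<in> q" "e = {x, y}"
      by (auto simp: edges_of_arcs_def)
    then have "x \<in> fst ` q" "y \<in> fst ` q" "x \<noteq> y"
      using symD[OF sym xy(1)] diag by force+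
    then show "\<exists>x\<in>fst ` q. \<exists>y\<in>fst ` q. x \<noteq> y \<and> e = {x, y}"
      using xy(2) by blast
  qed
  moreover have "card (fst ` q) \<le> N"
    using card_mono[OF _ V] by simp
  moreover have "no_isolated_vertex (fst ` q) (edges_of_arcs q)"
    by (force simp: no_isolated_vertex_def edges_of_arcs_def)
  moreover have "is_DCDC (edges_of_arcs q) K"
    unfolding is_DCDC_iff oriented_cycle_iff arcs_edges_of_arcs[OF sym]
  proof (intro conjI ballI)
    show K: "partition_on q K"
      using qK by (simp add: cycle_partitions_def)
    fix c assume c: "c \<in> K"
    then obtain k where "k \<ge> 3" "dicycle ({..<N} \<times> {..<N}) k c"
      using qK by (auto simp: cycle_partitions_def)
    moreover have "c \<subseteq> q"
      using c partition_onD1[OF K] by blast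
    ultimately show "\<exists>k\<ge>3. dicycle q k c"
      by (auto simp: dicycle_def)
  qed
  ultimately show ?thesis
    using V by (simp add: labelled_DCDC_pairs_def DCDC_pairs_def)
qed

lemma partition_of_labelled_cover:
  assumes "(V, E, C) \<in> labelled_DCDC_pairs N"
  shows "(arcs E, C) \<in> cycle_partitions N"
proof -
  have G: "simple_graph V E" "V \<subseteq> {..<N}" and C: "is_DCDC E C"
    using assms by (auto simp: labelled_DCDC_pairs_def DCDC_pairs_def)
  have sub: "arcs E \<subseteq> {..<N} \<times> {..<N}"
    using arcs_subset[OF G(1)] G(2) by blast
  have "\<exists>k\<ge>3. dicycle ({..<N} \<times> {..<N}) k c" if c: "c \<in> C" for c
  proof -
    obtain k where "k \<ge> 3" "dicycle (arcs E) k c"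
      using C c by (auto simp: is_DCDC_iff oriented_cycle_iff)
    then show ?thesis
      using sub unfolding dicycle_def by blast
  qed
  then show ?thesis
    using C sub by (simp add: cycle_partitions_def is_DCDC_iff)
qed

text \<open>The cycles are the same on both sides; only \<open>(V, E)\<close> is exchanged for its
  arc set.\<close>

lemma sum_labelled_DCDC_pairs:
  "(\<Sum>(V, E, C) \<in> labelled_DCDC_pairs N. 1 / real N ^ card E) =
    (\<Sum>(q, K) | (q, K) \<in> cycle_partitions N \<and> sym q. 1 / real N ^ card (q \<inter> upper_pairs N))"
proof (rule sum.reindex_bij_witness[where i = "\<lambda>(q, K). (fst ` q, edges_of_arcs q, K)"
      and j = "\<lambda>(V, E, C). (arcs E, C)"])
  fix P assume P: "P \<in> labelled_DCDC_pairs N"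
  obtain V E C where PV: "P = (V, E, C)" by (cases P)
  have G: "simple_graph V E" "no_isolated_vertex V E" "V \<subseteq> {..<N}"
    using P by (auto simp: PV labelled_DCDC_pairs_def DCDC_pairs_def)
  show "(case case P of (V, E, C) \<Rightarrow> (arcs E, C) of (q, K) \<Rightarrow> (fst ` q, edges_of_arcs q, K)) = P"
    by (simp add: PV edges_of_arcs_arcs[OF G(1)] fst_image_arcs[OF G(1,2)])
  have "sym (arcs E)"
    by (auto simp: sym_def arcs_def insert_commute)
  then show "(case P of (V, E, C) \<Rightarrow> (arcs E, C)) \<in> {(q, K). (q, K) \<in> cycle_partitions N \<and> sym q}"
    using partition_of_labelled_cover P by (simp add: PV)
  show "(case case P of (V, E, C) \<Rightarrow> (arcs E, C) of (q, K) \<Rightarrow> 1 / real N ^ card (q \<inter> upper_pairs N)) =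
      (case P of (V, E, C) \<Rightarrow> 1 / real N ^ card E)"
    by (simp add: PV card_arcs_upper[OF G(1,3)])
next
  fix p assume p: "p \<in> {(q, K). (q, K) \<in> cycle_partitions N \<and> sym q}"
  show "(case case p of (q, K) \<Rightarrow> (fst ` q, edges_of_arcs q, K) of (V, E, C) \<Rightarrow> (arcs E, C)) = p"
    using p by (auto simp: arcs_edges_of_arcs)
  show "(case p of (q, K) \<Rightarrow> (fst ` q, edges_of_arcs q, K)) \<in> labelled_DCDC_pairs N"
    using p labelled_cover_of_partition by auto
qed

section \<open>The mean of \<open>xi\<close>\<close>

theorem theorem1p9:
  fixes N :: nat
  assumes "N \<ge> 1"
  shows "gauss_mean N (xi N) =
    complex_of_real (\<Sum>X \<in> DCDC_pairs N // iso_rel N. class_weight N X)"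
proof -
  let ?A = "cycle_partitions N"
  have q: "fst a \<subseteq> {..<N} \<times> {..<N}" "(i, i) \<notin> fst a" if "a \<in> ?A" for a i
    using that cycle_partitions_arcs[of "fst a" "snd a"] by simp_all
  have "xi N = (\<lambda>M. \<Sum>a\<in>?A. \<Prod>e\<in>fst a. M $$ e)"
    by (simp add: fun_eq_iff xi_def case_prod_beta)
  then have "gauss_mean N (xi N) = (\<Sum>a\<in>?A. \<Prod>u\<in>upper_pairs N. pair_moment N (fst a) u)"
    using gauss_mean_sum_monomials[OF assms, of ?A fst] q by simp
  also have "\<dots> = (\<Sum>a\<in>?A. if sym (fst a) then 1 / of_nat N ^ card (fst a \<inter> upper_pairs N) else 0)"
    using q by (intro sum.cong prod_pair_moment) auto
  \<comment> \<open>Arc sets that are not symmetric drop out; the remaining pairs correspond to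
    labelled covers.\<close>
  also have "\<dots> = (\<Sum>a\<in>{a \<in> ?A. sym (fst a)}. 1 / of_nat N ^ card (fst a \<inter> upper_pairs N))"
    by (rule sum.inter_filter[symmetric, OF finite_cycle_partitions])
  also have "\<dots> = complex_of_real (\<Sum>(q, K) | (q, K) \<in> ?A \<and> sym q.
      1 / real N ^ card (q \<inter> upper_pairs N))"
  proof -
    have "{a \<in> ?A. sym (fst a)} = {(q, K). (q, K) \<in> ?A \<and> sym q}"
      by auto
    then show ?thesis
      by (simp add: case_prod_beta)
  qed
  finally show ?thesis
    by (simp only: sum_class_weight sum_labelled_DCDC_pairs)
qed

end
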